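(* Let $G$ be a finite connected undirected graph. In any candy-passing game on $G$ with $c$ candies, where $c\geq 4|E(G)|-|V(G)|$, every vertex $v\in V(G)$ eventually stabilizes; that is, there is a finite number of rounds after which the number of candies held by each vertex remains constant in all subsequent rounds.
   Context: The candy-passing game on a finite undirected graph $G$ (with vertex set $V(G)$ and edge set $E(G)$): initially a total of $c>0$ candies is distributed among the vertices of $G$ (each vertex holding a nonnegative integer number of candies). The game proceeds in rounds. In each round, simultaneously, every vertex $v$ that at the start of the round holds at least $\deg(v)$ candies passes one candy to each of its neighbors; a vertex holding fewer than $\deg(v)$ candies at the start of the round passes nothing. Here $\deg(v)$ is the number of neighbors of $v$. A vertex is said to have stabilized after some round if the number of candies it holds remains constant throughout all subsequent rounds. *)

theory Defs
  imports Main
begin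

definition finite_simple_graph :: "'a set \<Rightarrow> 'a set set \<Rightarrow> bool" where
  "finite_simple_graph V E \<longleftrightarrow> finite V \<and> (\<forall>e\<in>E. e \<subseteq> V \<and> card e = 2)"

definition connected_graph :: "'a set \<Rightarrow> 'a set set \<Rightarrow> bool" where
  "connected_graph V E \<longleftrightarrow> (\<forall>u\<in>V. \<forall>v\<in>V. (u, v) \<in> {(x, y). {x, y} \<in> E}\<^sup>*)"

definition neighbors :: "'a set set \<Rightarrow> 'a \<Rightarrow> 'a set" where
  "neighbors E v = {u. {u, v} \<in> E}"

definition degree :: "'a set set \<Rightarrow> 'a \<Rightarrow> nat" where
  "degree E v = card (neighbors E v)"

definition passes :: "'a set set \<Rightarrow> ('a \<Rightarrow> nat) \<Rightarrow> 'a \<Rightarrow> bool" where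
  "passes E f v \<longleftrightarrow> degree E v \<le> f v"

text \<open>The subtraction never truncates: it removes \<^term>\<open>degree E v\<close> candies only from a
  vertex that holds at least that many.\<close>

definition candy_round :: "'a set set \<Rightarrow> ('a \<Rightarrow> nat) \<Rightarrow> 'a \<Rightarrow> nat" where
  "candy_round E f v =
     (if passes E f v then f v - degree E v else f v) + card {u \<in> neighbors E v. passes E f u}"

definition candies :: "'a set set \<Rightarrow> ('a \<Rightarrow> nat) \<Rightarrow> nat \<Rightarrow> 'a \<Rightarrow> nat" where
  "candies E f n = (candy_round E ^^ n) f"

definition stabilized_after :: "'a set set \<Rightarrow> ('a \<Rightarrow> nat) \<Rightarrow> nat \<Rightarrow> 'a \<Rightarrow> bool" where
  "stabilized_after E f N v \<longleftrightarrow> (\<forall>n\<ge>N. candies E f n v = candies E f N v)"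

end

theory Submission
  imports Defs
begin

text \<open>A vertex \<open>v\<close> holding fewer than \<open>2 deg v\<close> candies does so forever, since it receives at most
  \<open>deg v\<close> of them per round. So either some vertex always holds at least twice its degree, or from
  some round on every vertex \<open>v\<close> holds at most \<open>2 deg v - 1\<close> candies; as these bounds add up to
  \<open>4 |E| - |V|\<close>, they are then all attained. In both cases some vertex passes in all late rounds.
  The amount held by such a vertex never increases, hence becomes constant, and this forces all its
  neighbors to pass in all late rounds too. By connectedness every vertex eventually always passes,
  and therefore stabilizes.\<close>

section \<open>Degrees and the handshake identity\<close>

lemma finite_simple_graph_finite_edges:
  assumes "finite_simple_graph V E"
  shows "finite E"
  using assms unfolding finite_simple_graph_def by (meson Pow_iff finite_Pow_iff finite_subset subsetI)

lemma neighbors_subset: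
  assumes "finite_simple_graph V E"
  shows "neighbors E v \<subseteq> V"
  using assms unfolding finite_simple_graph_def neighbors_def by blast

lemma finite_neighbors:
  assumes "finite_simple_graph V E"
  shows "finite (neighbors E v)"
  using assms neighbors_subset finite_subset unfolding finite_simple_graph_def by metis

lemma neighbors_sym: "u \<in> neighbors E v \<longleftrightarrow> v \<in> neighbors E u"
  by (simp add: neighbors_def insert_commute)

text \<open>Each edge at \<open>v\<close> is determined by its other endpoint. Counting edges
  instead of neighbors prepares the double count in \<open>sum_degree\<close>.\<close>

lemma degree_eq_card_incident_edges:
  assumes "finite_simple_graph V E"
  shows "degree E v = card {e \<in> E. v \<in> e}"
proof -
  have two: "card e = 2" if "e \<in> E" for e
    using assms that by (auto simp: finite_simple_graph_def)
  have "bij_betw (\<lambda>u. {u, v}) (neighbors E v) {e \<in> E. v \<in> e}"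
  proof (rule bij_betw_imageI)
    show "inj_on (\<lambda>u. {u, v}) (neighbors E v)"
      by (auto simp: inj_on_def doubleton_eq_iff)
    show "(\<lambda>u. {u, v}) ` neighbors E v = {e \<in> E. v \<in> e}"
    proof
      show "(\<lambda>u. {u, v}) ` neighbors E v \<subseteq> {e \<in> E. v \<in> e}"
        by (auto simp: neighbors_def)
      show "{e \<in> E. v \<in> e} \<subseteq> (\<lambda>u. {u, v}) ` neighbors E v"
      proof
        fix e assume e: "e \<in> {e \<in> E. v \<in> e}"
        then obtain a b where "e = {a, b}" "a \<noteq> b"
          using two by (metis (mono_tags) card_2_iff mem_Collect_eq)
        with e obtain u where "e = {u, v}" by auto
        with e show "e \<in> (\<lambda>u. {u, v}) ` neighbors E v"
          by (auto simp: neighbors_def)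
      qed
    qed
  qed
  then show ?thesis
    by (simp add: degree_def bij_betw_same_card)
qed

text \<open>Handshake identity: count the incident vertex-edge pairs in two ways, each edge having
  two endpoints.\<close>

lemma sum_degree:
  assumes "finite_simple_graph V E"
  shows "(\<Sum>v\<in>V. degree E v) = 2 * card E"
proof -
  have "card {v \<in> V. v \<in> e} = 2" if "e \<in> E" for e
  proof -
    have "{v \<in> V. v \<in> e} = e" using assms that by (auto simp: finite_simple_graph_def)
    then show ?thesis using assms that by (simp add: finite_simple_graph_def)
  qed
  then have "(\<Sum>v\<in>V. card {e \<in> E. v \<in> e}) = 2 * card E"
    using assms finite_simple_graph_finite_edges[OF assms]
    by (intro sum_multicount) (auto simp: finite_simple_graph_def)
  then show ?thesis
    by (simp add: degree_eq_card_incident_edges[OF assms])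
qed

section \<open>Candy balance of one round\<close>

lemma card_passing_neighbors_le:
  assumes "finite_simple_graph V E"
  shows "card {u \<in> neighbors E v. passes E f u} \<le> degree E v"
  unfolding degree_def by (rule card_mono) (auto simp: finite_neighbors[OF assms])

text \<open>With the outgoing candies moved to the left, the balance is free of truncated
  subtraction and can be summed or compared directly.\<close>

lemma candy_round_add:
  "candy_round E f v + (if passes E f v then degree E v else 0)
     = f v + card {u \<in> neighbors E v. passes E f u}"
  by (auto simp: candy_round_def passes_def)

text \<open>Both sides count the candies in transit, once by receiver and once by sender.\<close>

lemma sum_card_passing_neighbors:
  assumes "finite_simple_graph V E"
  shows "(\<Sum>v\<in>V. card {u \<in> neighbors E v. passes E f u})
           = (\<Sum>v\<in>V. if passes E f v then degree E v else 0)"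
proof -
  have fin: "finite V" using assms by (simp add: finite_simple_graph_def)
  have "(\<Sum>v\<in>V. card {u \<in> neighbors E v. passes E f u})
          = (\<Sum>v\<in>V. card {u \<in> V. u \<in> neighbors E v \<and> passes E f u})"
    using neighbors_subset[OF assms] by (intro sum.cong arg_cong[where f = card]) auto
  also have "\<dots> = (\<Sum>u\<in>V. card {v \<in> V. u \<in> neighbors E v \<and> passes E f u})"
    by (rule sum_multicount_gen) (use fin in auto)
  also have "\<dots> = (\<Sum>u\<in>V. if passes E f u then degree E u else 0)"
  proof (rule sum.cong)
    fix u
    have "{v \<in> V. u \<in> neighbors E v} = neighbors E u"
      using neighbors_subset[OF assms] neighbors_sym[of u E] by auto
    then show "card {v \<in> V. u \<in> neighbors E v \<and> passes E f u}
        = (if passes E f u then degree E u else 0)"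
      by (simp add: degree_def)
  qed simp
  finally show ?thesis .
qed

lemma sum_candy_round:
  assumes "finite_simple_graph V E"
  shows "(\<Sum>v\<in>V. candy_round E f v) = (\<Sum>v\<in>V. f v)"
proof -
  have "(\<Sum>v\<in>V. candy_round E f v + (if passes E f v then degree E v else 0))
          = (\<Sum>v\<in>V. f v + card {u \<in> neighbors E v. passes E f u})"
    by (simp only: candy_round_add)
  then show ?thesis
    unfolding sum.distrib sum_card_passing_neighbors[OF assms] by simp
qed

section \<open>Behavior over many rounds\<close>

lemma candies_Suc: "candies E f (Suc n) = candy_round E (candies E f n)"
  by (simp add: candies_def)

lemma sum_candies:
  assumes "finite_simple_graph V E"
  shows "(\<Sum>v\<in>V. candies E f n v) = (\<Sum>v\<in>V. f v)"
proof (induction n)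
  case 0
  show ?case by (simp add: candies_def)
next
  case (Suc n)
  then show ?case by (simp add: candies_Suc sum_candy_round[OF assms])
qed

text \<open>A passing vertex gains at most the \<open>degree E v\<close> candies that it gives away;
  any other starts below \<open>degree E v\<close> and gains at most that many.\<close>

lemma candies_less_persistent:
  assumes "finite_simple_graph V E"
    and "candies E f N v < 2 * degree E v" and "N \<le> n"
  shows "candies E f n v < 2 * degree E v"
  using assms(3)
proof (induction rule: dec_induct)
  case base
  show ?case by (fact assms(2))
next
  case (step n)
  then show ?case
    using card_passing_neighbors_le[OF assms(1), of v "candies E f n"]
    by (auto simp: candies_Suc candy_round_def passes_def)
qed

lemma eventually_passes_imp_eventually_constant:
  assumes "finite_simple_graph V E"
    and pass: "\<And>n. N \<le> n \<Longrightarrow> passes E (candies E f n) v"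
  obtains M where "N \<le> M" and "stabilized_after E f M v"
proof -
  \<comment> \<open>\<open>M\<close> is a round from \<open>N\<close> on in which \<open>v\<close>
    holds the fewest candies; as the amount cannot rise afterwards, it stays at this
    minimum.\<close>
  obtain M where M: "N \<le> M" and least: "\<And>n. N \<le> n \<Longrightarrow> candies E f M v \<le> candies E f n v"
    using ex_has_least_nat[of "\<lambda>n. N \<le> n" N "\<lambda>n. candies E f n v"] by auto
  have "candies E f n v \<le> candies E f M v" if "M \<le> n" for n
    using that
  proof (induction rule: dec_induct)
    case base
    show ?case by simp
  next
    case (step n)
    then have "passes E (candies E f n) v" using M pass by simp
    then show ?case
      using step.IH card_passing_neighbors_le[OF assms(1), of v "candies E f n"]
        candy_round_add[of E "candies E f n" v]
      by (simp add: candies_Suc)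
  qed
  with M least have "stabilized_after E f M v"
    unfolding stabilized_after_def by (meson le_antisym le_trans)
  with M show ?thesis by (rule that)
qed

text \<open>Once its amount is constant, \<open>v\<close> must recover all \<open>degree E v\<close>
  candies that it passes in a round, so every neighbor contributes one.\<close>

lemma neighbor_eventually_passes:
  assumes "finite_simple_graph V E"
    and pass: "\<And>n. N \<le> n \<Longrightarrow> passes E (candies E f n) v"
    and "u \<in> neighbors E v"
  shows "\<exists>M. \<forall>n\<ge>M. passes E (candies E f n) u"
proof -
  obtain M where M: "N \<le> M" and stab: "stabilized_after E f M v"
    using eventually_passes_imp_eventually_constant[OF assms(1) pass] .
  have "passes E (candies E f n) u" if n: "M \<le> n" for n
  proof -
    have "passes E (candies E f n) v" using M n pass by simp
    moreover have "candies E f (Suc n) v = candies E f n v"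
      using stab n unfolding stabilized_after_def by (metis le_SucI)
    ultimately have "card {u \<in> neighbors E v. passes E (candies E f n) u} = card (neighbors E v)"
      using candy_round_add[of E "candies E f n" v] by (simp add: candies_Suc degree_def)
    then have "{u \<in> neighbors E v. passes E (candies E f n) u} = neighbors E v"
      by (intro card_subset_eq finite_neighbors[OF assms(1)]) auto
    with assms(3) show ?thesis by blast
  qed
  then show ?thesis by blast
qed

lemma all_eventually_pass:
  assumes "finite_simple_graph V E" and "connected_graph V E"
    and "v \<in> V" and "u \<in> V"
    and "\<exists>N. \<forall>n\<ge>N. passes E (candies E f n) v"
  shows "\<exists>N. \<forall>n\<ge>N. passes E (candies E f n) u"
proof -
  have "(v, u) \<in> {(x, y). {x, y} \<in> E}\<^sup>*"
    using assms(2-4) by (simp add: connected_graph_def)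
  then show ?thesis
  proof (induction rule: rtrancl_induct)
    case base
    show ?case by (fact assms(5))
  next
    case (step y z)
    then have "z \<in> neighbors E y" by (simp add: neighbors_def insert_commute)
    with step.IH show ?case using neighbor_eventually_passes[OF assms(1)] by blast
  qed
qed

lemma finite_common_threshold:
  fixes P :: "'a \<Rightarrow> nat \<Rightarrow> bool"
  assumes "finite A" and "\<And>x. x \<in> A \<Longrightarrow> \<exists>N. \<forall>n\<ge>N. P x n"
  shows "\<exists>N. \<forall>x\<in>A. \<forall>n\<ge>N. P x n"
proof -
  obtain g where g: "\<And>x n. x \<in> A \<Longrightarrow> g x \<le> n \<Longrightarrow> P x n"
    using assms(2) by metis
  have "g x \<le> Max (g ` A)" if "x \<in> A" for x
    using assms(1) that by simp
  with g show ?thesis by (meson le_trans)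
qed

lemma exists_eventually_passing:
  assumes "finite_simple_graph V E" and "V \<noteq> {}"
    and "int (\<Sum>v\<in>V. f v) \<ge> 4 * int (card E) - int (card V)"
  shows "\<exists>v\<in>V. \<exists>N. \<forall>n\<ge>N. passes E (candies E f n) v"
proof (cases "\<exists>v\<in>V. \<forall>n. 2 * degree E v \<le> candies E f n v")
  case True
  then obtain v where "v \<in> V" and "\<And>n. 2 * degree E v \<le> candies E f n v" by blast
  then have "\<forall>n\<ge>0. passes E (candies E f n) v"
    unfolding passes_def by (metis le_add1 le_trans mult_2)
  with \<open>v \<in> V\<close> show ?thesis by blast
next
  case False
  have fin: "finite V" using assms(1) by (simp add: finite_simple_graph_def)
  have "\<exists>N. \<forall>n\<ge>N. candies E f n v < 2 * degree E v" if "v \<in> V" for v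
    using False that candies_less_persistent[OF assms(1)] by (meson not_le)
  then obtain N where N: "\<And>v n. v \<in> V \<Longrightarrow> N \<le> n \<Longrightarrow> candies E f n v < 2 * degree E v"
    using finite_common_threshold[OF fin, of "\<lambda>v n. candies E f n v < 2 * degree E v"] by blast
  have "passes E (candies E f n) v" if v: "v \<in> V" and n: "N \<le> n" for v n
  proof (rule ccontr)
    assume "\<not> passes E (candies E f n) v"
    \<comment> \<open>The bound from \<open>N\<close> forces \<open>degree E v\<close> to be
      positive, so holding fewer than \<open>degree E v\<close> candies leaves a strict gap.\<close>
    then have "candies E f n v + 1 < 2 * degree E v"
      using N[OF v n] by (auto simp: passes_def)
    moreover have "candies E f n w + 1 \<le> 2 * degree E w" if "w \<in> V" for w
      using N[OF that n] by simp
    \<comment> \<open>The added ones sum to \<open>card V\<close> and the right side to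
      \<open>4 * card E\<close>, so one strict gap puts the conserved total below the assumed
      bound.\<close>
    ultimately have "(\<Sum>w\<in>V. candies E f n w + 1) < (\<Sum>w\<in>V. 2 * degree E w)"
      using fin v by (intro sum_strict_mono_ex1) auto
    then have "(\<Sum>w\<in>V. f w) + card V < 4 * card E"
      unfolding sum.distrib sum_candies[OF assms(1)] sum_distrib_left[symmetric]
        sum_degree[OF assms(1)] by simp
    with assms(3) show False by linarith
  qed
  with assms(2) show ?thesis by blast
qed

theorem theorem1:
  fixes V :: "'a set" and E :: "'a set set" and f :: "'a \<Rightarrow> nat" and c :: nat
  assumes "finite_simple_graph V E"
    and "connected_graph V E"
    and "(\<Sum>v\<in>V. f v) = c"
    and "c > 0"
    and "int c \<ge> 4 * int (card E) - int (card V)"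
  shows "\<exists>N. \<forall>v\<in>V. stabilized_after E f N v"
proof -
  have fin: "finite V" using assms(1) by (simp add: finite_simple_graph_def)
  \<comment> \<open>An empty sum would make \<open>c\<close> zero.\<close>
  have "V \<noteq> {}" using assms(3,4) by auto
  then obtain v where "v \<in> V" "\<exists>N. \<forall>n\<ge>N. passes E (candies E f n) v"
    using exists_eventually_passing[OF assms(1)] assms(3,5) by metis
  then have "\<exists>N. \<forall>n\<ge>N. passes E (candies E f n) u" if "u \<in> V" for u
    using all_eventually_pass[OF assms(1,2)] that by blast
  then have "\<exists>N. stabilized_after E f N u" if "u \<in> V" for u
    using eventually_passes_imp_eventually_constant[OF assms(1)] that by metis
  \<comment> \<open>Stabilization is inherited by later rounds, which gives the form needed to
    choose one threshold for all vertices.\<close>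
  then have "\<exists>N. \<forall>n\<ge>N. stabilized_after E f n u" if "u \<in> V" for u
    using that unfolding stabilized_after_def by (metis le_trans)
  then show ?thesis
    using finite_common_threshold[OF fin, of "\<lambda>u n. stabilized_after E f n u"] by blast
qed

end
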